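(* Let $m<n$ and $\lambda>0$. Let $K$ denote the number (assumed finite) of distinct real positive definite symmetric solutions $S_1,\ldots,S_K$ of the equation $$([xx^T]S+\lambda\,\mathrm{Id})(S[xx^T]+\lambda\,\mathrm{Id})=[xy^T]\,S\,[yx^T],$$ and for $k=1,\ldots,K$ let $\sqrt{S}_k$ denote the unique positive definite square root of $S_k$. Then the set of equilibria $(A,B)$ of the SG algorithm for which $A$ has maximal rank $m$ can be decomposed into $K$ sub-varieties of $\mathbb{R}^{n\times m}\times\mathbb{R}^{n\times n}$, formed respectively (for $k=1,\dots,K$) by the pairs $(A,B)$ such that $A$ belongs to $$\mathcal{A}_k=\{A\in\mathbb{R}^{n\times m}: A^TA=S_k\}=\{U\sqrt{S}_k: U\in\mathbb{R}^{n\times m},\ U^TU=\mathrm{Id}\}$$ and $$B=A[yx^T]A^TW^{-1},\quad\text{where } W=A[xx^T]A^T+\lambda\,\mathrm{Id}.$$ Likewise, the equilibria $(A,B,C)$ of the EMA algorithm with $A$ of maximal rank $m$ are the triples with $A\in\mathcal{A}_k$ for some $k$, $B$ given by the same formula, and $C=A$.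
   Context: Let $(x,y)$ be a random pair in $\mathbb{R}^m\times\mathbb{R}^m$ with finite second moments, and write $[xx^T]=\mathbb{E}[xx^T]$, $[yx^T]=\mathbb{E}[yx^T]$, $[xy^T]=[yx^T]^T$. For $A,C\in\mathbb{R}^{n\times m}$ and $B\in\mathbb{R}^{n\times n}$ put $R(A,B,C)=BA[xx^T]-C[yx^T]$. The (continuous) dynamical system of the EMA algorithm in the linear case, with a constant $\alpha\neq 1$, is $$\dot A=-(B^TR(A,B,C)+\lambda A),\quad \dot B=-(R(A,B,C)A^T+\lambda B),\quad \dot C=(1-\alpha)(A-C).$$ The dynamical system of the SG algorithm is obtained by setting $C=A$ and dropping the third equation: $$\dot A=-(B^TR(A,B,A)+\lambda A),\quad \dot B=-(R(A,B,A)A^T+\lambda B).$$ An equilibrium is a point where the right-hand side of the system vanishes. *)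

theory Defs
  imports "HOL-Probability.Probability"
begin

text \<open>The matrix \<open>[y x\<^sup>T]\<close>, i.e. the entrywise expectation of \<open>y x\<^sup>T\<close>. It is the Bochner integral
  of a matrix-valued function, so it is meaningful only under an integrability hypothesis
  (finite second moments); otherwise it defaults to 0.\<close>

definition moment_matrix :: "'w measure \<Rightarrow> ('w \<Rightarrow> real^'m) \<Rightarrow> ('w \<Rightarrow> real^'k) \<Rightarrow> real^'k^'m" where
  "moment_matrix M Y X = (\<integral>\<omega>. (\<chi> i j. Y \<omega> $ i * X \<omega> $ j) \<partial>M)"

text \<open>Below, \<open>Sxx\<close> and \<open>Syx\<close> stand for \<open>[x x\<^sup>T]\<close> and \<open>[y x\<^sup>T]\<close>; an \<open>n \<times> m\<close> matrix has type
  \<^typ>\<open>real^'m^'n\<close>.\<close>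

definition residual ::
  "real^'m^'m \<Rightarrow> real^'m^'m \<Rightarrow> real^'m^'n \<Rightarrow> real^'n^'n \<Rightarrow> real^'m^'n \<Rightarrow> real^'m^'n" where
  "residual Sxx Syx A B C = B ** A ** Sxx - C ** Syx"

definition ema_field ::
  "real^'m^'m \<Rightarrow> real^'m^'m \<Rightarrow> real \<Rightarrow> real
    \<Rightarrow> (real^'m^'n) \<times> (real^'n^'n) \<times> (real^'m^'n) \<Rightarrow> (real^'m^'n) \<times> (real^'n^'n) \<times> (real^'m^'n)" where
  "ema_field Sxx Syx lam alpha = (\<lambda>(A, B, C).
     (- (transpose B ** residual Sxx Syx A B C + lam *\<^sub>R A),
      - (residual Sxx Syx A B C ** transpose A + lam *\<^sub>R B),
      (1 - alpha) *\<^sub>R (A - C)))"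

definition sg_field ::
  "real^'m^'m \<Rightarrow> real^'m^'m \<Rightarrow> real
    \<Rightarrow> (real^'m^'n) \<times> (real^'n^'n) \<Rightarrow> (real^'m^'n) \<times> (real^'n^'n)" where
  "sg_field Sxx Syx lam = (\<lambda>(A, B).
     (- (transpose B ** residual Sxx Syx A B A + lam *\<^sub>R A),
      - (residual Sxx Syx A B A ** transpose A + lam *\<^sub>R B)))"

definition equilibrium :: "('a::zero \<Rightarrow> 'a) \<Rightarrow> 'a \<Rightarrow> bool" where
  "equilibrium f z \<longleftrightarrow> f z = 0"

definition spd :: "real^'m^'m \<Rightarrow> bool" where
  "spd S \<longleftrightarrow> transpose S = S \<and> (\<forall>v. v \<noteq> 0 \<longrightarrow> v \<bullet> (S *v v) > 0)"

definition spd_sqrt :: "real^'m^'m \<Rightarrow> real^'m^'m" where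
  "spd_sqrt S = (THE Q. spd Q \<and> Q ** Q = S)"

definition spd_solutions :: "real^'m^'m \<Rightarrow> real^'m^'m \<Rightarrow> real \<Rightarrow> (real^'m^'m) set" where
  "spd_solutions Sxx Syx lam =
     {S. spd S \<and>
         (Sxx ** S + lam *\<^sub>R mat 1) ** (S ** Sxx + lam *\<^sub>R mat 1) = transpose Syx ** S ** Syx}"

definition W_mat :: "real^'m^'m \<Rightarrow> real \<Rightarrow> real^'m^'n \<Rightarrow> real^'n^'n" where
  "W_mat Sxx lam A = A ** Sxx ** transpose A + lam *\<^sub>R mat 1"

text \<open>Since \<^const>\<open>matrix_inv\<close> is total, the formula is meaningful only when \<open>W\<close> is invertible.\<close>

definition B_mat :: "real^'m^'m \<Rightarrow> real^'m^'m \<Rightarrow> real \<Rightarrow> real^'m^'n \<Rightarrow> real^'n^'n" where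
  "B_mat Sxx Syx lam A = A ** Syx ** transpose A ** matrix_inv (W_mat Sxx lam A)"

definition gram_fibre :: "real^'m^'m \<Rightarrow> (real^'m^'n) set" where
  "gram_fibre S = {A. transpose A ** A = S}"

definition sg_component ::
  "real^'m^'m \<Rightarrow> real^'m^'m \<Rightarrow> real \<Rightarrow> real^'m^'m \<Rightarrow> ((real^'m^'n) \<times> (real^'n^'n)) set" where
  "sg_component Sxx Syx lam S = {(A, B). A \<in> gram_fibre S \<and> B = B_mat Sxx Syx lam A}"

text \<open>A (not necessarily irreducible) real algebraic sub-variety: the common zero set of finitely
  many polynomial functions.\<close>

definition algebraic_variety :: "('a::real_normed_vector) set \<Rightarrow> bool" where
  "algebraic_variety V \<longleftrightarrow>
     (\<exists>P. finite P \<and> (\<forall>p\<in>P. real_polynomial_function p) \<and> V = {z. \<forall>p\<in>P. p z = 0})"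

end

theory Submission
  imports Defs
begin

text \<open>Write \<open>P = [x x\<^sup>T]\<close>, \<open>Q = [y x\<^sup>T]\<close>. The second equilibrium equation says \<open>B W = A Q A\<^sup>T\<close>, which
  determines \<open>B\<close> because \<open>W\<close> is positive definite. With \<open>S = A\<^sup>T A\<close> and \<open>N = P S + \<lambda>\<close> we have
  \<open>W A = A N\<close>, so for \<open>A\<close> of full column rank \<open>N\<close> is invertible, \<open>B = A Q N\<^sup>-\<^sup>T A\<^sup>T\<close> and the
  residual is \<open>- \<lambda> A Q N\<^sup>-\<^sup>T\<close>. The first equation then becomes
  \<open>A N\<^sup>-\<^sup>1 Q\<^sup>T S Q N\<^sup>-\<^sup>T = A\<close>, that is, \<open>N N\<^sup>T = Q\<^sup>T S Q\<close>. The positive definite square root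
  comes from an orthonormal eigenbasis, found by maximising the quadratic form on spheres.\<close>

section \<open>Spectral theorem for self-adjoint maps\<close>

text \<open>Rayleigh's principle: a maximiser \<open>v\<close> of \<open>x \<bullet> f x\<close> on
  the compact unit sphere of \<open>V\<close> is an eigenvector, since the first variation at
  \<open>v\<close> in the direction of the defect \<open>w = c *\<^sub>R v - f v\<close> must
  vanish.\<close>

lemma selfadjoint_eigenvector:
  fixes f :: "'a::euclidean_space \<Rightarrow> 'a"
  assumes lin: "linear f" and sa: "\<And>x y. f x \<bullet> y = x \<bullet> f y"
    and V: "subspace V" and inv: "f ` V \<subseteq> V" and ne: "V \<noteq> {0}"
  obtains v c where "v \<in> V" "norm v = 1" "f v = c *\<^sub>R v"
proof -
  interpret f: linear f by fact
  define D where "D = sphere 0 1 \<inter> V"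
  have "compact D"
    unfolding D_def by (intro compact_Int_closed compact_sphere closed_subspace V)
  obtain u where "u \<in> V" "u \<noteq> 0" using ne V subspace_0 by blast
  then have "u /\<^sub>R norm u \<in> D" by (simp add: D_def V subspace_scale)
  moreover have "continuous_on D (\<lambda>x. x \<bullet> f x)"
    by (intro continuous_intros linear_continuous_on linear_linear[THEN iffD2] lin)
  ultimately obtain v where v: "v \<in> D" and max: "\<And>x. x \<in> D \<Longrightarrow> x \<bullet> f x \<le> v \<bullet> f v"
    using continuous_attains_sup[OF \<open>compact D\<close>, of "\<lambda>x. x \<bullet> f x"] by auto
  define c where "c = v \<bullet> f v"
  have vV: "v \<in> V" and vn: "norm v = 1" using v by (auto simp: D_def)
  have vv: "v \<bullet> v = 1" using vn by (simp add: dot_square_norm)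
  \<comment> \<open>Homogenising the maximality: \<open>g\<close> is a quadratic form that is
    nonnegative on all of \<open>V\<close> and vanishes at \<open>v\<close>.\<close>
  define g where "g = (\<lambda>x. c * (x \<bullet> x) - x \<bullet> f x)"
  have g_nonneg: "0 \<le> g x" if "x \<in> V" for x
  proof (cases "x = 0")
    case False
    then have "x /\<^sub>R norm x \<in> D" using that by (simp add: D_def V subspace_scale)
    from max[OF this] have "(x \<bullet> f x) / (norm x)\<^sup>2 \<le> c"
      by (simp add: c_def f.scale power2_eq_square divide_inverse mult_ac)
    then show ?thesis using False by (simp add: g_def dot_square_norm divide_le_eq)
  qed (simp add: g_def f.zero)
  define w where "w = c *\<^sub>R v - f v"
  have wV: "w \<in> V"
    unfolding w_def using inv vV V by (auto intro!: subspace_diff subspace_scale)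
  define b where "b = g w"
  have b: "b \<ge> 0" using g_nonneg[OF wV] by (simp add: b_def)
  \<comment> \<open>This is \<open>g (v + t *\<^sub>R w)\<close>: the constant term is
    \<open>g v = 0\<close>, and self-adjointness merges the two mixed terms.\<close>
  have key: "0 \<le> 2 * t * (w \<bullet> w) + t\<^sup>2 * b" for t
  proof -
    have "v + t *\<^sub>R w \<in> V" using vV wV V by (intro subspace_add subspace_scale)
    from g_nonneg[OF this] have "0 \<le> g (v + t *\<^sub>R w)" .
    also have "g (v + t *\<^sub>R w) = 2 * t * (w \<bullet> (c *\<^sub>R v - f v)) + t\<^sup>2 * b"
      using sa[of v w] vv
      by (simp add: g_def b_def c_def f.add f.scale inner_add_left inner_add_right inner_diff_right
          power2_eq_square inner_commute algebra_simps)
    finally show ?thesis by (simp add: w_def)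
  qed
  have "w \<bullet> w = 0"
  proof (rule ccontr)
    assume "w \<bullet> w \<noteq> 0"
    then have pos: "w \<bullet> w > 0" by (metis inner_gt_zero_iff inner_zero_left)
    \<comment> \<open>At \<open>t = - s\<close> the linear term outweighs the quadratic one; the
      \<open>+ 1\<close> keeps the denominator positive when \<open>b = 0\<close>.\<close>
    define s where "s = (w \<bullet> w) / (b + 1)"
    have s: "w \<bullet> w = s * (b + 1)" "s > 0" using b pos by (simp_all add: s_def)
    have "2 * (- s) * (w \<bullet> w) + (- s)\<^sup>2 * b = - (s\<^sup>2 * (b + 2))"
      by (simp add: s(1) power2_eq_square algebra_simps)
    moreover have "s\<^sup>2 * (b + 2) > 0" using b s(2) by simp
    ultimately show False using key[of "- s"] by linarith
  qed
  then have "f v = c *\<^sub>R v" by (simp add: w_def)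
  with that vV vn show thesis by blast
qed

text \<open>Induction on the dimension: split off a unit eigenvector \<open>v\<close>; by
  self-adjointness its orthogonal complement in \<open>V\<close> is again invariant. Stating the
  result for invariant subspaces is what lets the induction run.\<close>

theorem selfadjoint_orthonormal_eigenbasis:
  fixes f :: "'a::euclidean_space \<Rightarrow> 'a"
  assumes lin: "linear f" and sa: "\<And>x y. f x \<bullet> y = x \<bullet> f y"
    and "subspace V" and "f ` V \<subseteq> V"
  shows "\<exists>B. finite B \<and> B \<subseteq> V \<and> pairwise orthogonal B \<and> (\<forall>b\<in>B. norm b = 1)
           \<and> (\<forall>b\<in>B. \<exists>c. f b = c *\<^sub>R b) \<and> span B = V"
  using assms(3,4)
proof (induction "dim V" arbitrary: V rule: less_induct)
  case less
  note V = less.prems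
  show ?case
  proof (cases "V = {0}")
    case True
    then show ?thesis by (intro exI[of _ "{}"]) auto
  next
    case False
    obtain v c where v: "v \<in> V" "norm v = 1" "f v = c *\<^sub>R v"
      using selfadjoint_eigenvector[OF lin sa V False] by blast
    have vv: "v \<bullet> v = 1" using v by (simp add: dot_square_norm)
    define V' where "V' = {y \<in> V. v \<bullet> y = 0}"
    have sub: "subspace V'"
      using V(1) unfolding V'_def subspace_def by (auto simp: inner_add_right)
    have inv: "f ` V' \<subseteq> V'"
    proof (safe)
      fix y assume y: "y \<in> V'"
      have "v \<bullet> f y = c * (v \<bullet> y)" using sa[of v y] v(3) by simp
      then show "f y \<in> V'" using y V(2) by (auto simp: V'_def)
    qed
    have "v \<notin> V'" using vv by (simp add: V'_def)
    then have "V' \<subset> V" using v(1) unfolding V'_def by blast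
    then have "dim V' < dim V"
      using dim_psubset[of V' V] by (simp add: span_eq_iff[THEN iffD2, OF sub] span_eq_iff[THEN iffD2, OF V(1)])
    from less.hyps[OF this sub inv] obtain B where B: "finite B" "B \<subseteq> V'" "pairwise orthogonal B"
      "\<forall>b\<in>B. norm b = 1" "\<forall>b\<in>B. \<exists>c. f b = c *\<^sub>R b" "span B = V'" by blast
    have "span (insert v B) = V"
    proof (intro subset_antisym subsetI)
      fix x assume "x \<in> span (insert v B)"
      moreover have "span (insert v B) \<subseteq> V"
        by (rule span_minimal) (use v(1) B(2) V(1) V'_def in auto)
      ultimately show "x \<in> V" by blast
    next
      fix x assume x: "x \<in> V"
      \<comment> \<open>Removing the component along \<open>v\<close> leaves a vector of the
        complement, which \<open>B\<close> spans.\<close>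
      have "x - (v \<bullet> x) *\<^sub>R v \<in> V'"
        using x v(1) V(1) vv by (auto simp: V'_def inner_diff_right intro!: subspace_diff subspace_scale)
      then show "x \<in> span (insert v B)"
        unfolding B(6)[symmetric] by (auto simp: span_insert)
    qed
    moreover have "pairwise orthogonal (insert v B)"
      using B(2,3) by (auto simp: pairwise_insert orthogonal_def V'_def inner_commute)
    moreover have "insert v B \<subseteq> V" using v(1) B(2) by (auto simp: V'_def)
    ultimately show ?thesis
      using B(1,4,5) v by (intro exI[of _ "insert v B"]) auto
  qed
qed

section \<open>Positive definite square roots\<close>

lemma symmetric_matrix_inner:
  fixes S :: "real^'m^'m"
  assumes "transpose S = S"
  shows "(S *v x) \<bullet> y = x \<bullet> (S *v y)"
  using assms dot_lmul_matrix[of x S y] transpose_matrix_vector[of S x] by simp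

text \<open>In an orthonormal eigenbasis of \<open>S\<close>, let \<open>Q\<close> multiply each
  coordinate by the square root of the corresponding eigenvalue, which is positive by
  definiteness.\<close>

lemma spd_sqrt_exists:
  fixes S :: "real^'m^'m"
  assumes "spd S"
  shows "\<exists>Q. spd Q \<and> Q ** Q = S"
proof -
  have sym: "transpose S = S" and pos: "\<And>v. v \<noteq> 0 \<Longrightarrow> v \<bullet> (S *v v) > 0"
    using assms by (auto simp: spd_def)
  obtain B where B: "finite B" "pairwise orthogonal B" "\<forall>b\<in>B. norm b = 1"
      "\<forall>b\<in>B. \<exists>c. S *v b = c *\<^sub>R b" "span B = (UNIV :: (real^'m) set)"
    using selfadjoint_orthonormal_eigenbasis[of "(*v) S" UNIV] symmetric_matrix_inner[OF sym] by auto
  obtain c where c: "\<And>b. b \<in> B \<Longrightarrow> S *v b = c b *\<^sub>R b" using B(4) by metis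
  have orth: "b \<bullet> b' = (if b = b' then 1 else 0)" if "b \<in> B" "b' \<in> B" for b b'
    using B(2,3) that by (auto simp: pairwise_def orthogonal_def dot_square_norm)
  have c_pos: "c b > 0" if "b \<in> B" for b
  proof -
    have "b \<noteq> 0" using B(3) that by auto
    from pos[OF this] show ?thesis using c[OF that] orth[OF that that] by simp
  qed
  define q where "q x = (\<Sum>b\<in>B. (sqrt (c b) * (b \<bullet> x)) *\<^sub>R b)" for x
  have "linear q"
    unfolding q_def
    by (rule linearI) (simp_all add: inner_add_right algebra_simps sum.distrib scaleR_sum_right)
  define Q where "Q = matrix q"
  have Qv: "Q *v x = q x" for x unfolding Q_def using matrix_vector_mul(2)[OF \<open>linear q\<close>] by metis
  have q_eig: "q b = sqrt (c b) *\<^sub>R b" if "b \<in> B" for b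
  proof -
    have "q b = (\<Sum>b'\<in>B. if b' = b then sqrt (c b) *\<^sub>R b else 0)"
      unfolding q_def using that by (intro sum.cong) (auto simp: orth)
    then show ?thesis using B(1) that by simp
  qed
  have q_sa: "q x \<bullet> y = x \<bullet> q y" for x y
    unfolding q_def by (simp add: inner_sum_left inner_sum_right inner_commute mult_ac)
  have "transpose Q = Q"
  proof -
    have "transpose Q *v x = Q *v x" for x
    proof -
      have "(transpose Q *v x) \<bullet> y = (Q *v x) \<bullet> y" for y
        using dot_lmul_matrix[of x Q y] q_sa[of x y] by (simp add: Qv)
      then show ?thesis by (metis vector_eq_rdot)
    qed
    then show ?thesis by (simp add: matrix_eq)
  qed
  moreover have "x \<bullet> (Q *v x) > 0" if "x \<noteq> 0" for x
  proof -
    have eq: "x \<bullet> (Q *v x) = (\<Sum>b\<in>B. sqrt (c b) * (b \<bullet> x)\<^sup>2)"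
      by (simp add: Qv q_def inner_sum_right power2_eq_square inner_commute mult_ac)
    \<comment> \<open>A vector orthogonal to the spanning set \<open>B\<close> is orthogonal to
      itself, so some term of the sum is strictly positive.\<close>
    have "\<exists>b\<in>B. b \<bullet> x \<noteq> 0"
    proof (rule ccontr)
      assume "\<not> ?thesis"
      then have "orthogonal x b" if "b \<in> B" for b
        using that by (auto simp: orthogonal_def inner_commute)
      then have "orthogonal x x" using orthogonal_to_span[of x B x] by (simp add: B(5))
      then show False using that by (simp add: orthogonal_self)
    qed
    then obtain b where "b \<in> B" "b \<bullet> x \<noteq> 0" by blast
    then show ?thesis unfolding eq
      using B(1) c_pos
      by (intro sum_pos2[of _ b]) (auto intro!: mult_pos_pos mult_nonneg_nonneg less_imp_le[OF c_pos])
  qed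
  moreover have "Q ** Q = S"
  proof -
    \<comment> \<open>Both sides are linear and agree on the eigenbasis.\<close>
    have "q (q x) = S *v x" for x
    proof (rule linear_eq_on_span[where f = "\<lambda>x. q (q x)" and g = "(*v) S" and B = B])
      show "linear (\<lambda>x. q (q x))" using linear_compose[OF \<open>linear q\<close> \<open>linear q\<close>] by (simp add: o_def)
      show "x \<in> span B" by (simp add: B(5))
      show "q (q b) = S *v b" if "b \<in> B" for b
        using q_eig[OF that] linear_scale[OF \<open>linear q\<close>] c[OF that] c_pos[OF that] by simp
    qed simp
    then show ?thesis by (simp add: matrix_eq Qv flip: matrix_vector_mul_assoc)
  qed
  ultimately show ?thesis by (auto simp: spd_def)
qed

text \<open>It is enough to compare \<open>P\<close> and \<open>Q\<close> on an eigenbasis of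
  \<open>P\<close>, where each eigenvector turns out to be one of \<open>Q\<close> for the same
  eigenvalue.\<close>

lemma spd_sqrt_unique:
  fixes P Q :: "real^'m^'m"
  assumes "spd P" and "spd Q" and eq: "P ** P = Q ** Q"
  shows "P = Q"
proof -
  have sym: "transpose P = P" and pos: "\<And>v. v \<noteq> 0 \<Longrightarrow> v \<bullet> (P *v v) > 0"
    and posQ: "\<And>v. v \<noteq> 0 \<Longrightarrow> v \<bullet> (Q *v v) > 0"
    using assms by (auto simp: spd_def)
  obtain B where B: "\<forall>b\<in>B. norm b = 1"
      "\<forall>b\<in>B. \<exists>c. P *v b = c *\<^sub>R b" "span B = (UNIV :: (real^'m) set)"
    using selfadjoint_orthonormal_eigenbasis[of "(*v) P" UNIV] symmetric_matrix_inner[OF sym] by auto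
  have "P *v x = Q *v x" for x
  proof (rule linear_eq_on_span[where f = "(*v) P" and g = "(*v) Q" and B = B])
    show "x \<in> span B" by (simp add: B(3))
    fix b assume b: "b \<in> B"
    then obtain c where c: "P *v b = c *\<^sub>R b" using B(2) by blast
    have bb: "b \<noteq> 0" using B(1) b by auto
    have "c * (b \<bullet> b) > 0" using pos[OF bb] c by simp
    then have c0: "c > 0" by (simp add: zero_less_mult_iff not_less[THEN iffD2, OF inner_ge_zero])
    \<comment> \<open>\<open>(Q + c)(Q - c) b = (P\<^sup>2 - c\<^sup>2) b = 0\<close> and \<open>Q + c\<close> is positive definite\<close>
    define w where "w = Q *v b - c *\<^sub>R b"
    have "Q *v (Q *v b) = P *v (P *v b)" by (simp add: matrix_vector_mul_assoc eq)
    also have "\<dots> = (c * c) *\<^sub>R b" by (simp add: c matrix_vector_mult_scaleR)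
    finally have "Q *v w = - (c *\<^sub>R w)"
      by (simp add: w_def matrix_vector_mult_diff_distrib matrix_vector_mult_scaleR scaleR_diff_right)
    then have "w \<bullet> (Q *v w) = - (c * (w \<bullet> w))" by simp
    moreover have "c * (w \<bullet> w) \<ge> 0" using c0 by simp
    ultimately have "w = 0" using posQ[of w] by fastforce
    then show "P *v b = Q *v b" by (simp add: w_def c)
  qed simp_all
  then show ?thesis by (simp add: matrix_eq)
qed

lemma spd_sqrt:
  fixes S :: "real^'m^'m"
  assumes "spd S"
  shows "\<exists>!Q. spd Q \<and> Q ** Q = S" and "spd (spd_sqrt S)" and "spd_sqrt S ** spd_sqrt S = S"
proof -
  show *: "\<exists>!Q. spd Q \<and> Q ** Q = S"
    using spd_sqrt_exists[OF assms] spd_sqrt_unique by (metis (no_types, lifting))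
  show "spd (spd_sqrt S)" "spd_sqrt S ** spd_sqrt S = S"
    using theI'[OF *] by (simp_all add: spd_sqrt_def)
qed

section \<open>Invertibility and Gram matrices\<close>

lemma invertible_if_positive_definite:
  fixes M :: "real^'m^'m"
  assumes "\<And>v. v \<noteq> 0 \<Longrightarrow> v \<bullet> (M *v v) > 0"
  shows "invertible M"
  unfolding invertible_left_inverse matrix_left_invertible_ker
  using assms by (metis inner_zero_right less_irrefl)

lemma matrix_inv_inverse:
  assumes "invertible M"
  shows "M ** matrix_inv M = mat 1" and "matrix_inv M ** M = mat 1"
  using someI_ex[OF assms[unfolded invertible_def]] by (auto simp: matrix_inv_def)

lemma inner_gram:
  fixes A :: "real^'m^'n"
  shows "v \<bullet> ((transpose A ** A) *v w) = (A *v v) \<bullet> (A *v w)"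
  by (metis dot_lmul_matrix inner_commute matrix_vector_mul_assoc transpose_matrix_vector)

text \<open>The quadratic form of the Gram matrix at \<open>v\<close> is the squared norm of
  \<open>A *v v\<close>, so definiteness means that \<open>A\<close> has trivial kernel. This
  translates the rank condition into one on \<open>S\<close>.\<close>

lemma spd_gram_iff:
  fixes A :: "real^'m^'n"
  shows "spd (transpose A ** A) \<longleftrightarrow> rank A = CARD('m)"
proof -
  have "rank A = CARD('m) \<longleftrightarrow> (\<forall>v. A *v v = 0 \<longrightarrow> v = 0)"
    by (simp add: full_rank_injective flip: matrix_left_invertible_injective matrix_left_invertible_ker)
  then show ?thesis
    by (auto simp: spd_def inner_gram matrix_transpose_mul inner_gt_zero_iff)
qed

section \<open>Second moment matrices\<close>

text \<open>Row \<open>i\<close> of the outer product is \<open>x $ i *\<^sub>R x\<close>, so its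
  norm is exactly the squared norm of \<open>x\<close>, which is integrable. Without integrability
  the Bochner integral would default to 0 and could not be exchanged with linear maps.\<close>

lemma outer_product_integrable:
  fixes X :: "'w \<Rightarrow> real^'m"
  assumes [measurable]: "X \<in> borel_measurable M" and int: "integrable M (\<lambda>\<omega>. (norm (X \<omega>))\<^sup>2)"
  shows "integrable M (\<lambda>\<omega>. (\<chi> i j. X \<omega> $ i * X \<omega> $ j))"
proof (rule Bochner_Integration.integrable_bound[OF int])
  have "continuous_on UNIV (\<lambda>x::real^'m. \<chi> i j. x $ i * x $ j)"
    by (intro continuous_intros)
  from borel_measurable_continuous_on[OF this, of X M]
  show "(\<lambda>\<omega>. \<chi> i j. X \<omega> $ i * X \<omega> $ j) \<in> borel_measurable M" by simp
  have "norm (\<chi> i j. x $ i * x $ j) = (norm x)\<^sup>2" for x :: "real^'m"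
  proof -
    have "(\<chi> i j. x $ i * x $ j) = (\<chi> i. x $ i *\<^sub>R x)" by (simp add: vec_eq_iff)
    also have "norm \<dots> = L2_set (\<lambda>i. norm (x $ i) * norm x) UNIV" by (subst norm_vec_def) simp
    also have "\<dots> = norm x * norm x" by (simp add: norm_vec_def flip: L2_set_left_distrib)
    finally show ?thesis by (simp add: power2_eq_square)
  qed
  then show "AE \<omega> in M. norm (\<chi> i j. X \<omega> $ i * X \<omega> $ j) \<le> norm ((norm (X \<omega>))\<^sup>2)" by simp
qed

text \<open>Expectation commutes with the linear maps \<open>transpose\<close> and
  \<open>\<lambda>A. v \<bullet> (A *v v)\<close>; under the second one the integrand becomes the
  square of \<open>X \<omega> \<bullet> v\<close>.\<close>

lemma moment_matrix_symmetric_psd: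
  fixes X :: "'w \<Rightarrow> real^'m"
  assumes "X \<in> borel_measurable M" and "integrable M (\<lambda>\<omega>. (norm (X \<omega>))\<^sup>2)"
  shows "transpose (moment_matrix M X X) = moment_matrix M X X"
    and "v \<bullet> (moment_matrix M X X *v v) \<ge> 0"
proof -
  note int = outer_product_integrable[OF assms]
  have "linear (transpose :: real^'m^'m \<Rightarrow> _)"
    by (rule linearI) (simp_all add: transpose_def vec_eq_iff)
  from integral_bounded_linear[OF this[unfolded linear_conv_bounded_linear] int]
  show "transpose (moment_matrix M X X) = moment_matrix M X X"
    by (simp add: moment_matrix_def transpose_def mult.commute)
  have "linear (\<lambda>A::real^'m^'m. v \<bullet> (A *v v))"
    by (rule linearI) (simp_all add: matrix_vector_mult_add_rdistrib inner_add_right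
        flip: scaleR_matrix_vector_assoc)
  from integral_bounded_linear[OF this[unfolded linear_conv_bounded_linear] int]
  have "v \<bullet> (moment_matrix M X X *v v) = (\<integral>\<omega>. v \<bullet> ((\<chi> i j. X \<omega> $ i * X \<omega> $ j) *v v) \<partial>M)"
    by (simp add: moment_matrix_def)
  also have "\<dots> = (\<integral>\<omega>. (X \<omega> \<bullet> v)\<^sup>2 \<partial>M)"
    by (rule Bochner_Integration.integral_cong)
      (simp_all add: inner_vec_def matrix_vector_mult_def power2_eq_square sum_product
        sum_distrib_left mult_ac)
  also have "\<dots> \<ge> 0" by simp
  finally show "v \<bullet> (moment_matrix M X X *v v) \<ge> 0" .
qed

section \<open>The equilibrium equations\<close>

text \<open>The form of \<open>W\<close> at \<open>v\<close> is that of \<open>P\<close> at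
  \<open>transpose A *v v\<close> plus \<open>lam * (v \<bullet> v)\<close>, hence positive. So
  \<open>matrix_inv\<close> in \<open>B_mat\<close> is a genuine inverse.\<close>

lemma invertible_W_mat:
  fixes A :: "real^'m^'n"
  assumes psd: "\<And>v. v \<bullet> (P *v v) \<ge> 0" and "lam > 0"
  shows "invertible (W_mat P lam A)"
proof (rule invertible_if_positive_definite)
  fix v :: "real^'n" assume v: "v \<noteq> 0"
  have "v \<bullet> (W_mat P lam A *v v)
      = (transpose A *v v) \<bullet> (P *v (transpose A *v v)) + lam * (v \<bullet> v)"
    by (simp add: W_mat_def matrix_vector_mult_add_rdistrib inner_add_right dot_lmul_matrix
        flip: scaleR_matrix_vector_assoc matrix_vector_mul_assoc)
  moreover have "lam * (v \<bullet> v) > 0" using v assms(2) by simp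
  ultimately show "v \<bullet> (W_mat P lam A *v v) > 0" using psd[of "transpose A *v v"] by linarith
qed

lemma matrix_diff_ldistrib: "A ** (B - C) = A ** B - A ** (C :: real^'k^'m)"
  by (simp add: matrix_matrix_mult_def vec_eq_iff sum_subtractf right_diff_distrib)

lemma matrix_diff_rdistrib: "(A - B) ** C = A ** C - B ** (C :: real^'k^'m)"
  by (simp add: matrix_matrix_mult_def vec_eq_iff sum_subtractf left_diff_distrib)

lemma matrix_add_rdistrib: "(A + B) ** C = A ** C + B ** (C :: real^'k^'m)"
  by (simp add: matrix_matrix_mult_def vec_eq_iff sum.distrib distrib_right)

lemma transpose_add: "transpose (A + B) = transpose A + transpose B"
  by (simp add: transpose_def vec_eq_iff)

lemma mult_matrix_inv_eq_iff:
  fixes B C M :: "real^'n^'n"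
  assumes "invertible M"
  shows "B = C ** matrix_inv M \<longleftrightarrow> B ** M = C"
  using matrix_inv_inverse[OF assms] by (metis matrix_mul_assoc matrix_mul_rid)

text \<open>The form without an inverse serves twice: it matches the second equilibrium equation,
  and it is polynomial in \<open>(A, B)\<close>.\<close>

lemma B_mat_iff:
  fixes A :: "real^'m^'n"
  assumes "\<And>v. v \<bullet> (P *v v) \<ge> 0" and "lam > 0"
  shows "B = B_mat P Q lam A \<longleftrightarrow> B ** W_mat P lam A = A ** Q ** transpose A"
  unfolding B_mat_def by (rule mult_matrix_inv_eq_iff[OF invertible_W_mat[OF assms]])

lemma second_equation_iff:
  fixes A :: "real^'m^'n"
  assumes "\<And>v. v \<bullet> (P *v v) \<ge> 0" and "lam > 0"
  shows "residual P Q A B A ** transpose A + lam *\<^sub>R B = 0 \<longleftrightarrow> B = B_mat P Q lam A"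
proof -
  have "residual P Q A B A ** transpose A + lam *\<^sub>R B
      = B ** W_mat P lam A - A ** Q ** transpose A"
    by (simp add: residual_def W_mat_def matrix_diff_rdistrib matrix_add_ldistrib matrix_mul_assoc
        matrix_scalar_ac)
  then show ?thesis unfolding B_mat_iff[OF assms] by simp
qed

text \<open>The intertwining relations \<open>WA\<close> and \<open>AW\<close> trade the inverse of
  the \<open>n \<times> n\<close> matrix \<open>W\<close> for that of the
  \<open>m \<times> m\<close> matrix \<open>N\<close>. The equation then has \<open>A\<close> as a
  common left factor, which full column rank allows to cancel.\<close>

lemma first_equation_iff:
  fixes A :: "real^'m^'n" and P Q :: "real^'m^'m"
  assumes sym: "transpose P = P" and psd: "\<And>v. v \<bullet> (P *v v) \<ge> 0" and lam: "lam > 0"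
    and rank: "rank A = CARD('m)" and B: "B = B_mat P Q lam A"
  shows "transpose B ** residual P Q A B A + lam *\<^sub>R A = 0
           \<longleftrightarrow> transpose A ** A \<in> spd_solutions P Q lam"
proof -
  define S where "S = transpose A ** A"
  define W where "W = W_mat P lam A"
  define N where "N = P ** S + lam *\<^sub>R mat 1"
  define N' where "N' = S ** P + lam *\<^sub>R mat 1"
  define R where "R = residual P Q A B A"
  have tS: "transpose S = S" by (simp add: S_def matrix_transpose_mul)
  have tN: "transpose N = N'"
    by (simp add: N_def N'_def transpose_add matrix_transpose_mul sym tS transpose_scalar)
  obtain A' where A': "A' ** A = mat 1"
    using rank by (auto simp: full_rank_injective simp flip: matrix_left_invertible_injective)
  have A_cancel: "A ** C = A ** D \<longleftrightarrow> C = D" for C D :: "real^'k^'m"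
    using A' by (metis matrix_mul_assoc matrix_mul_lid)
  have A'T: "transpose A ** transpose A' = mat 1"
    by (metis A' matrix_transpose_mul transpose_mat)
  have invW: "invertible W" unfolding W_def by (rule invertible_W_mat[OF psd lam])
  define V where "V = matrix_inv W"
  have V: "W ** V = mat 1" "V ** W = mat 1"
    using matrix_inv_inverse[OF invW] by (auto simp: V_def)
  have WA: "W ** A = A ** N"
    by (simp add: W_def W_mat_def N_def S_def matrix_add_rdistrib matrix_add_ldistrib
        matrix_mul_assoc matrix_scalar_ac flip: scalar_matrix_assoc)
  have AW: "transpose A ** W = N' ** transpose A"
    by (simp add: W_def W_mat_def N'_def S_def matrix_add_rdistrib matrix_add_ldistrib
        matrix_mul_assoc matrix_scalar_ac flip: scalar_matrix_assoc)
  \<comment> \<open>\<open>N\<close> need not be symmetric, so its inverse is exhibited: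
    \<open>A' ** V ** A\<close>, the inverse of \<open>W\<close> compressed to the column space of
    \<open>A\<close>.\<close>
  have "(A' ** V ** A) ** N = A' ** (V ** W) ** A" by (simp add: WA flip: matrix_mul_assoc)
  then have "(A' ** V ** A) ** N = mat 1" by (simp add: V A')
  then have "invertible N" unfolding invertible_left_inverse by blast
  then obtain L where L: "N ** L = mat 1" "L ** N = mat 1" by (auto simp: invertible_def)
  define L' where "L' = transpose L"
  have L': "N' ** L' = mat 1" "L' ** N' = mat 1"
    using L by (metis L'_def tN matrix_transpose_mul transpose_mat)+
  have "transpose A ** V = L' ** (N' ** transpose A) ** V" by (simp add: L' matrix_mul_assoc)
  also have "\<dots> = L' ** transpose A ** (W ** V)" by (simp add: matrix_mul_assoc flip: AW)
  finally have AV: "transpose A ** V = L' ** transpose A" by (simp add: V)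
  have "B = A ** Q ** (transpose A ** V)"
    by (simp add: B B_mat_def V_def W_def matrix_mul_assoc)
  then have B': "B = A ** Q ** L' ** transpose A" by (simp add: AV matrix_mul_assoc)
  \<comment> \<open>Inserting \<open>L' ** N' = mat 1\<close> after \<open>A ** Q\<close> gives both
    terms the factor \<open>A ** Q ** L'\<close>; since \<open>N'\<close> is \<open>S ** P\<close>
    plus \<open>lam\<close> times the identity, only the \<open>lam\<close> part survives.\<close>
  have "R = A ** Q ** L' ** (S ** P) - A ** Q ** (L' ** N')"
    by (simp add: R_def residual_def B' S_def L'(2) matrix_mul_assoc)
  also have "\<dots> = - (lam *\<^sub>R (A ** Q ** L'))"
    by (simp add: N'_def matrix_add_ldistrib matrix_mul_assoc matrix_scalar_ac scalar_matrix_assoc)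
  finally have R: "R = - (lam *\<^sub>R (A ** Q ** L'))" .
  have tB: "transpose B = A ** L ** transpose Q ** transpose A"
    by (simp add: B' L'_def matrix_transpose_mul matrix_mul_assoc)
  have "transpose B ** R = - (lam *\<^sub>R (transpose B ** (A ** Q ** L')))"
    using matrix_diff_ldistrib[of "transpose B" 0 "lam *\<^sub>R (A ** Q ** L')"]
      scalar_matrix_assoc[of lam "transpose B" "A ** Q ** L'"]
    by (simp add: R matrix_scalar_ac)
  also have "transpose B ** (A ** Q ** L') = A ** (L ** (transpose Q ** S ** Q) ** L')"
    by (simp add: tB S_def matrix_mul_assoc)
  \<comment> \<open>Both summands carry the factor \<open>lam\<close>, which is nonzero and divides
    out.\<close>
  finally have "transpose B ** R + lam *\<^sub>R A = 0
      \<longleftrightarrow> A ** (L ** (transpose Q ** S ** Q) ** L') = A ** mat 1"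
    using lam by auto
  also have "\<dots> \<longleftrightarrow> L ** (transpose Q ** S ** Q) ** L' = mat 1" by (rule A_cancel)
  \<comment> \<open>Multiply by \<open>N\<close> on the left and \<open>N'\<close> on the right, or
    by their inverses \<open>L\<close> and \<open>L'\<close> for the converse.\<close>
  also have "\<dots> \<longleftrightarrow> N ** N' = transpose Q ** S ** Q"
  proof
    assume "L ** (transpose Q ** S ** Q) ** L' = mat 1"
    then have "N ** N' = N ** (L ** (transpose Q ** S ** Q) ** L') ** N'" by simp
    also have "\<dots> = (N ** L) ** (transpose Q ** S ** Q) ** (L' ** N')"
      by (simp only: matrix_mul_assoc)
    finally show "N ** N' = transpose Q ** S ** Q" by (simp add: L L')
  next
    assume "N ** N' = transpose Q ** S ** Q"
    then have "L ** (transpose Q ** S ** Q) ** L' = L ** (N ** N') ** L'" by simp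
    also have "\<dots> = (L ** N) ** (N' ** L')" by (simp only: matrix_mul_assoc)
    finally show "L ** (transpose Q ** S ** Q) ** L' = mat 1" by (simp add: L L')
  qed
  also have "\<dots> \<longleftrightarrow> S \<in> spd_solutions P Q lam"
    using rank by (simp add: spd_solutions_def spd_gram_iff S_def N_def N'_def)
  finally show ?thesis by (simp add: R_def S_def)
qed

text \<open>The second equation yields the formula for \<open>B\<close> under which the first one
  was analysed. The rank condition disappears on the right because a positive definite Gram matrix
  already forces it.\<close>

lemma sg_equilibrium_iff:
  fixes A :: "real^'m^'n" and P Q :: "real^'m^'m"
  assumes "transpose P = P" and "\<And>v. v \<bullet> (P *v v) \<ge> 0" and "lam > 0"
  shows "equilibrium (sg_field P Q lam) (A, B) \<and> rank A = CARD('m)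
           \<longleftrightarrow> transpose A ** A \<in> spd_solutions P Q lam \<and> B = B_mat P Q lam A"
proof -
  have "rank A = CARD('m)" if "transpose A ** A \<in> spd_solutions P Q lam"
    using that by (simp add: spd_solutions_def spd_gram_iff)
  moreover have "equilibrium (sg_field P Q lam) (A, B)
      \<longleftrightarrow> transpose B ** residual P Q A B A + lam *\<^sub>R A = 0
        \<and> residual P Q A B A ** transpose A + lam *\<^sub>R B = 0"
    by (simp only: equilibrium_def sg_field_def prod.case zero_prod_def prod.inject neg_equal_0_iff_equal)
  ultimately show ?thesis
    using first_equation_iff[OF assms] second_equation_iff[OF assms(2,3)] by blast
qed

text \<open>As \<open>1 - alpha\<close> is nonzero, the third component forces \<open>C = A\<close>,
  and the other two then coincide with the SG field.\<close>

lemma ema_equilibrium_iff: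
  assumes "alpha \<noteq> 1"
  shows "equilibrium (ema_field P Q lam alpha) (A, B, C)
           \<longleftrightarrow> C = A \<and> equilibrium (sg_field P Q lam) (A, B)"
  using assms
  by (auto simp: equilibrium_def sg_field_def ema_field_def zero_prod_def)

section \<open>Parametrisation of the fibres of the Gram map\<close>

text \<open>Polar decomposition: with \<open>H\<close> the square root of \<open>S\<close> and
  \<open>G\<close> its inverse, \<open>A ** G\<close> has orthonormal columns and
  \<open>A = (A ** G) ** H\<close>.\<close>

lemma gram_fibre_eq_isometry_image:
  fixes S :: "real^'m^'m"
  assumes "spd S"
  shows "(gram_fibre S :: (real^'m^'n) set)
    = {U ** spd_sqrt S | U :: real^'m^'n. transpose U ** U = mat 1}"
proof -
  define H where "H = spd_sqrt S"
  have H: "spd H" "H ** H = S" using spd_sqrt[OF assms] by (auto simp: H_def)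
  have tH: "transpose H = H" using H(1) by (simp add: spd_def)
  have "invertible H" using H(1) by (intro invertible_if_positive_definite) (simp add: spd_def)
  then obtain G where G: "H ** G = mat 1" "G ** H = mat 1" by (auto simp: invertible_def)
  have tG: "transpose G ** H = mat 1" by (metis G(1) matrix_transpose_mul tH transpose_mat)
  show ?thesis
    unfolding gram_fibre_def H_def[symmetric]
  proof (intro subset_antisym subsetI)
    fix A :: "real^'m^'n" assume "A \<in> {A. transpose A ** A = S}"
    then have A: "transpose A ** A = S" by simp
    have "transpose (A ** G) ** (A ** G) = transpose G ** (transpose A ** A) ** G"
      by (simp add: matrix_transpose_mul matrix_mul_assoc)
    also have "\<dots> = (transpose G ** H) ** (H ** G)"
      by (simp only: A flip: H(2)) (simp only: matrix_mul_assoc)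
    also have "\<dots> = mat 1" by (simp add: tG G)
    finally have "transpose (A ** G) ** (A ** G) = mat 1" .
    moreover have "A = A ** G ** H" by (simp add: G(2) flip: matrix_mul_assoc)
    ultimately show "A \<in> {U ** H | U. transpose U ** U = mat 1}" by blast
  next
    fix A :: "real^'m^'n" assume "A \<in> {U ** H | U. transpose U ** U = mat 1}"
    then obtain U where A: "A = U ** H" and U: "transpose U ** U = mat 1" by blast
    have "transpose (U ** H) ** (U ** H) = H ** (transpose U ** U) ** H"
      by (simp add: matrix_transpose_mul matrix_mul_assoc tH)
    then show "A \<in> {A. transpose A ** A = S}" by (simp add: A U H(2))
  qed
qed

text \<open>An injection of the index types selects distinct standard basis vectors as columns of
  \<open>U\<close>. This is what makes the components nonempty.\<close>

lemma isometry_exists: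
  assumes "CARD('m) \<le> CARD('n)"
  shows "\<exists>U :: real^'m^'n. transpose U ** U = mat 1"
proof -
  obtain f :: "'m \<Rightarrow> 'n" where f: "inj f"
    using assms card_le_inj[of "UNIV :: 'm set" "UNIV :: 'n set"] by auto
  define U :: "real^'m^'n" where "U = (\<chi> i j. if i = f j then 1 else 0)"
  have "(\<Sum>k\<in>UNIV. (if k = f i then 1 else 0) * (if k = f j then 1 else 0))
      = (if i = j then 1 else (0::real))" for i j
  proof -
    have "(\<Sum>k\<in>UNIV. (if k = f i then 1 else 0) * (if k = f j then 1 else (0::real)))
        = (\<Sum>k\<in>UNIV. if k = f i then if i = j then 1 else 0 else 0)"
      by (intro sum.cong) (auto simp: inj_eq[OF f])
    then show ?thesis by simp
  qed
  then have "transpose U ** U = mat 1"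
    by (simp add: U_def transpose_def matrix_matrix_mult_def mat_def vec_eq_iff)
  then show ?thesis by blast
qed

section \<open>Components as algebraic varieties\<close>

text \<open>Lifts the scalar notion to matrices, so that varieties can be read off from matrix
  equations through closure under sums, products and transposes.\<close>

definition matrix_polynomial :: "('a::real_normed_vector \<Rightarrow> real^'k^'l) \<Rightarrow> bool" where
  "matrix_polynomial F \<longleftrightarrow> (\<forall>i j. real_polynomial_function (\<lambda>z. F z $ i $ j))"

lemma matrix_polynomial_linear:
  fixes F :: "'a::euclidean_space \<Rightarrow> real^'k^'l"
  assumes "bounded_linear F"
  shows "matrix_polynomial F"
  unfolding matrix_polynomial_def
  by (intro allI real_polynomial_function.intros(1) bounded_linear_compose[OF bounded_linear_vec_nth]
      assms)

lemma matrix_polynomial_intros: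
  "matrix_polynomial (\<lambda>z. C)"
  "matrix_polynomial F \<Longrightarrow> matrix_polynomial G \<Longrightarrow> matrix_polynomial (\<lambda>z. F z + G z)"
  "matrix_polynomial F \<Longrightarrow> matrix_polynomial H \<Longrightarrow> matrix_polynomial (\<lambda>z. F z ** H z)"
  "matrix_polynomial F \<Longrightarrow> matrix_polynomial (\<lambda>z. transpose (F z))"
  by (auto simp: matrix_polynomial_def matrix_matrix_mult_def transpose_def
      intro!: real_polynomial_function_sum)

text \<open>The defining polynomials are the differences of corresponding entries, finite in number
  because the index types are finite.\<close>

lemma algebraic_variety_matrix_eq:
  assumes "matrix_polynomial F" and "matrix_polynomial G"
  shows "algebraic_variety {z. F z = G z}"
proof -
  define P where "P = range (\<lambda>(i, j) z. F z $ i $ j - G z $ i $ j)"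
  have "{z. F z = G z} = {z. \<forall>p\<in>P. p z = 0}"
    by (auto simp: P_def vec_eq_iff)
  moreover have "\<forall>p\<in>P. real_polynomial_function p"
    using assms by (auto simp: P_def matrix_polynomial_def)
  moreover have "finite P" by (simp add: P_def)
  ultimately show ?thesis unfolding algebraic_variety_def by (intro exI[of _ P] conjI)
qed

lemma algebraic_variety_Int:
  assumes "algebraic_variety V" and "algebraic_variety W"
  shows "algebraic_variety (V \<inter> W)"
proof -
  obtain P Q where "finite P" "\<forall>p\<in>P. real_polynomial_function p" "V = {z. \<forall>p\<in>P. p z = 0}"
    and "finite Q" "\<forall>p\<in>Q. real_polynomial_function p" "W = {z. \<forall>p\<in>Q. p z = 0}"
    using assms unfolding algebraic_variety_def by blast
  then show ?thesis
    unfolding algebraic_variety_def by (intro exI[of _ "P \<union> Q"]) auto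
qed

text \<open>\<open>B_mat\<close> is only rational in \<open>A\<close>; multiplying through by the
  invertible \<open>W\<close> turns its graph into a polynomial condition.\<close>

lemma sg_component_algebraic_variety:
  fixes P :: "real^'m^'m"
  assumes "\<And>v. v \<bullet> (P *v v) \<ge> 0" and "lam > 0"
  shows "algebraic_variety (sg_component P Q lam S :: ((real^'m^'n) \<times> (real^'n^'n)) set)"
proof -
  have "(sg_component P Q lam S :: ((real^'m^'n) \<times> (real^'n^'n)) set)
      = {z. transpose (fst z) ** fst z = S}
        \<inter> {z. snd z ** W_mat P lam (fst z) = fst z ** Q ** transpose (fst z)}"
    by (auto simp: sg_component_def gram_fibre_def B_mat_iff[OF assms])
  then show ?thesis
    unfolding W_mat_def
    by (auto intro!: algebraic_variety_Int algebraic_variety_matrix_eq matrix_polynomial_intros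
        matrix_polynomial_linear[OF bounded_linear_fst] matrix_polynomial_linear[OF bounded_linear_snd])
qed

section \<open>Decomposition of the sets of equilibria\<close>

text \<open>Several clauses guard the totalised notions: unique existence of the root justifies the
  description in \<open>spd_sqrt\<close>, and invertibility of \<open>W\<close> that of
  \<open>matrix_inv\<close>. Nonemptiness and disjointness ensure that \<open>K\<close> really
  counts the pieces.\<close>

theorem corollary4p6:
  fixes M :: "'w measure"
    and X Y :: "'w \<Rightarrow> real^'m"
    and Sxx Syx :: "real^'m^'m"
    and lam alpha :: real
    and K :: nat
    and S :: "nat \<Rightarrow> real^'m^'m"
  assumes "prob_space M"
    and "X \<in> borel_measurable M" and "Y \<in> borel_measurable M"
    and "integrable M (\<lambda>\<omega>. (norm (X \<omega>))\<^sup>2)" and "integrable M (\<lambda>\<omega>. (norm (Y \<omega>))\<^sup>2)"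
    and "Sxx = moment_matrix M X X" and "Syx = moment_matrix M Y X"
    and "alpha \<noteq> 1"
    and "CARD('m) < CARD('n)"
    and "lam > 0"
    and "finite (spd_solutions Sxx Syx lam)"
    and "K = card (spd_solutions Sxx Syx lam)"
    and "bij_betw S {1..K} (spd_solutions Sxx Syx lam)"
  shows "(\<forall>k\<in>{1..K}. \<exists>!Q. spd Q \<and> Q ** Q = S k) \<and>
    (\<forall>k\<in>{1..K}. (gram_fibre (S k) :: (real^'m^'n) set)
        = {U ** spd_sqrt (S k) | U :: real^'m^'n. transpose U ** U = mat 1}) \<and>
    (\<forall>k\<in>{1..K}. \<forall>A \<in> (gram_fibre (S k) :: (real^'m^'n) set). invertible (W_mat Sxx lam A)) \<and>
    {(A :: real^'m^'n, B :: real^'n^'n).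
        equilibrium (sg_field Sxx Syx lam) (A, B) \<and> rank A = CARD('m)}
      = (\<Union>k\<in>{1..K}. sg_component Sxx Syx lam (S k)) \<and>
    (\<forall>k\<in>{1..K}. algebraic_variety
        (sg_component Sxx Syx lam (S k) :: ((real^'m^'n) \<times> (real^'n^'n)) set)) \<and>
    (\<forall>k\<in>{1..K}. (sg_component Sxx Syx lam (S k) :: ((real^'m^'n) \<times> (real^'n^'n)) set) \<noteq> {}) \<and>
    disjoint_family_on
      (\<lambda>k. sg_component Sxx Syx lam (S k) :: ((real^'m^'n) \<times> (real^'n^'n)) set) {1..K} \<and>
    {(A :: real^'m^'n, B :: real^'n^'n, C :: real^'m^'n).
        equilibrium (ema_field Sxx Syx lam alpha) (A, B, C) \<and> rank A = CARD('m)}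
      = {(A, B, C). \<exists>k\<in>{1..K}. A \<in> gram_fibre (S k) \<and> B = B_mat Sxx Syx lam A \<and> C = A}"
proof -
  have P: "transpose Sxx = Sxx" "\<And>v. v \<bullet> (Sxx *v v) \<ge> 0"
    unfolding \<open>Sxx = moment_matrix M X X\<close>
    by (rule moment_matrix_symmetric_psd[OF assms(2,4)])+
  have solutions: "spd_solutions Sxx Syx lam = S ` {1..K}"
    using assms(13) by (simp add: bij_betw_def)
  have spd: "spd (S k)" if "k \<in> {1..K}" for k
    using that solutions by (auto simp: spd_solutions_def)
  have sg: "equilibrium (sg_field Sxx Syx lam) (A, B) \<and> rank A = CARD('m)
      \<longleftrightarrow> (\<exists>k\<in>{1..K}. A \<in> gram_fibre (S k) \<and> B = B_mat Sxx Syx lam A)"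
    for A :: "real^'m^'n" and B
    unfolding sg_equilibrium_iff[OF P assms(10)] solutions gram_fibre_def by blast
  have ema: "equilibrium (ema_field Sxx Syx lam alpha) (A, B, C) \<and> rank A = CARD('m)
      \<longleftrightarrow> (\<exists>k\<in>{1..K}. A \<in> gram_fibre (S k) \<and> B = B_mat Sxx Syx lam A \<and> C = A)"
    for A C :: "real^'m^'n" and B
    unfolding ema_equilibrium_iff[OF assms(8)] using sg[of A B] by blast
  have nonempty: "(sg_component Sxx Syx lam (S k) :: ((real^'m^'n) \<times> (real^'n^'n)) set) \<noteq> {}"
    if "k \<in> {1..K}" for k
  proof -
    obtain U :: "real^'m^'n" where "transpose U ** U = mat 1"
      using isometry_exists assms(9) less_imp_le by blast
    then have "U ** spd_sqrt (S k) \<in> gram_fibre (S k)"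
      unfolding gram_fibre_eq_isometry_image[OF spd[OF that]] by blast
    then show ?thesis by (auto simp: sg_component_def)
  qed
  have disjoint: "disjoint_family_on
      (\<lambda>k. sg_component Sxx Syx lam (S k) :: ((real^'m^'n) \<times> (real^'n^'n)) set) {1..K}"
    unfolding disjoint_family_on_def
  proof (intro ballI impI)
    fix k l assume "k \<in> {1..K}" "l \<in> {1..K}" "k \<noteq> l"
    \<comment> \<open>A matrix \<open>A\<close> has only one Gram matrix, so fibres over distinct
      solutions cannot meet.\<close>
    then have "S k \<noteq> S l" using assms(13) by (auto simp: bij_betw_def inj_on_eq_iff)
    then show "sg_component Sxx Syx lam (S k)
        \<inter> (sg_component Sxx Syx lam (S l) :: ((real^'m^'n) \<times> (real^'n^'n)) set) = {}"
      by (auto simp: sg_component_def gram_fibre_def)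
  qed
  show ?thesis
  proof (intro conjI ballI)
    show "{(A :: real^'m^'n, B :: real^'n^'n).
        equilibrium (sg_field Sxx Syx lam) (A, B) \<and> rank A = CARD('m)}
      = (\<Union>k\<in>{1..K}. sg_component Sxx Syx lam (S k))"
      unfolding sg sg_component_def by blast
    show "{(A :: real^'m^'n, B :: real^'n^'n, C :: real^'m^'n).
        equilibrium (ema_field Sxx Syx lam alpha) (A, B, C) \<and> rank A = CARD('m)}
      = {(A, B, C). \<exists>k\<in>{1..K}. A \<in> gram_fibre (S k) \<and> B = B_mat Sxx Syx lam A \<and> C = A}"
      unfolding ema ..
  qed (use spd in \<open>simp_all add: spd_sqrt(1) gram_fibre_eq_isometry_image nonempty disjoint
      invertible_W_mat[OF P(2) assms(10)] sg_component_algebraic_variety[OF P(2) assms(10)]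
      del: One_nat_def\<close>)
qed

end
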